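(* Suppose $q$ is real with $0<q<1$, $a\in\mathbb{R}$, and $\lambda<0$. For $n\ge0$ let $$Q_n(x)=\sum_{j,k\ge0}\begin{bmatrix}k\\ j\end{bmatrix}_q\begin{bmatrix}n-j\\ k\end{bmatrix}_q a^{k-j}x^{n-j-k}\lambda^jq^{\binom k2+\binom j2+j} =\sum_{j\ge0}\begin{bmatrix}n-j\\ j\end{bmatrix}_q\frac{(-a/x;q)_{n-j}}{(-a/x;q)_j}\lambda^jx^{n-2j}q^{j^2}.$$ Then there is a purely discrete positive measure $\mu$ on $\mathbb{R}$ such that for all $m,n\ge0$ $$\int_{-\infty}^{\infty}Q_n(x)Q_m(x)\,d\mu(x)=(-\lambda)^nq^{\binom{n+1}{2}}\delta_{mn}.$$
   Context: $(a;q)_0=1$, $(a;q)_n=(1-a)(1-aq)\cdots(1-aq^{n-1})$ for $n\ge 1$. The $q$-binomial coefficient is $\begin{bmatrix}n\\ k\end{bmatrix}_q=\frac{(q;q)_n}{(q;q)_k(q;q)_{n-k}}$ for integers $n\ge k\ge0$, and it is $0$ when $n<k$ (in particular for negative $n$ and $k\ge 0$). The first expression for $Q_n$ is a polynomial of degree $n$ in $x$ and serves as the definition; the second is the same polynomial wherever the expression makes sense. These are the denominator polynomials of the continued fraction $\frac{1}{x+a}\genfrac{}{}{0pt}{}{}{+}\frac{\lambda q}{x+aq}\genfrac{}{}{0pt}{}{}{+}\frac{\lambda q^2}{x+aq^2}\genfrac{}{}{0pt}{}{}{+}\cdots$, i.e. $Q_0=1$, $Q_1=x+a$, $Q_{k+1}(x)=(x+aq^k)Q_k(x)+\lambda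 q^kQ_{k-1}(x)$ for $k>0$. *)

theory Defs
  imports "HOL-Analysis.Analysis"
begin

definition qpoch :: "real \<Rightarrow> real \<Rightarrow> nat \<Rightarrow> real" where
  "qpoch a q n = (\<Prod>i<n. 1 - a * q ^ i)"

(* The upper argument is an integer, so that qbinom q (int n - int j) k
   involves no truncated subtraction and vanishes for j > n. *)
definition qbinom :: "real \<Rightarrow> int \<Rightarrow> nat \<Rightarrow> real" where
  "qbinom q n k =
     (if n < int k then 0
      else qpoch q q (nat n) / (qpoch q q k * qpoch q q (nat n - k)))"

(* The summation over all j, k \<ge> 0 is cut down to j, k \<le> n; by Q_term_eq_0 every
   omitted summand is 0.  The truncated exponents k - j and n - j - k only matter
   for j \<le> k and j + k \<le> n, since otherwise a q-binomial factor is 0. *)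
definition Q_term :: "real \<Rightarrow> real \<Rightarrow> real \<Rightarrow> nat \<Rightarrow> real \<Rightarrow> nat \<Rightarrow> nat \<Rightarrow> real" where
  "Q_term q a lam n x j k =
     qbinom q (int k) j * qbinom q (int n - int j) k
       * a ^ (k - j) * x ^ (n - j - k) * lam ^ j * q ^ ((k choose 2) + (j choose 2) + j)"

definition Q :: "real \<Rightarrow> real \<Rightarrow> real \<Rightarrow> nat \<Rightarrow> real \<Rightarrow> real" where
  "Q q a lam n x = (\<Sum>j\<le>n. \<Sum>k\<le>n. Q_term q a lam n x j k)"

lemma Q_term_eq_0: "j > k \<or> j + k > n \<Longrightarrow> Q_term q a lam n x j k = 0"
  by (auto simp: Q_term_def qbinom_def)

(* A positive Borel measure on the real line that is concentrated on a countable set,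
   i.e. a countable sum of point masses; no finiteness is imposed. *)
definition purely_discrete :: "real measure \<Rightarrow> bool" where
  "purely_discrete M \<longleftrightarrow>
     sets M = sets borel \<and> (\<exists>S. countable S \<and> emeasure M (UNIV - S) = 0)"

lemma qpoch_0 [simp]: "qpoch a q 0 = 1"
  by (simp add: qpoch_def)

lemma qpoch_Suc: "qpoch a q (Suc n) = qpoch a q n * (1 - a * q ^ n)"
  by (simp add: qpoch_def)

lemma qpoch_add: "qpoch a q (m + n) = qpoch a q m * qpoch (a * q ^ m) q n"
  by (induction n) (simp_all add: qpoch_Suc power_add mult.assoc)

lemma qpoch_self_pos:
  assumes "0 < q" "q < 1" shows "qpoch q q n > 0"
proof -
  have "q * q ^ i < 1" for i
    using assms power_Suc_less_one[of q i] by simp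
  then show ?thesis unfolding qpoch_def by (intro prod_pos) simp
qed

lemma qbinom_int: "k \<le> n \<Longrightarrow> qbinom q (int n) k = qpoch q q n / (qpoch q q k * qpoch q q (n - k))"
  by (simp add: qbinom_def)

lemma qbinom_gt: "n < k \<Longrightarrow> qbinom q (int n) k = 0"
  by (simp add: qbinom_def)

lemma qbinom_0:
  assumes "0 < q" "q < 1" shows "qbinom q (int n) 0 = 1"
  using qpoch_self_pos[OF assms, of n] by (simp add: qbinom_int)

lemma qbinom_self:
  assumes "0 < q" "q < 1" shows "qbinom q (int n) n = 1"
  using qpoch_self_pos[OF assms, of n] by (simp add: qbinom_int)

lemma qbinom_Suc:
  assumes q: "0 < q" "q < 1" and i: "i \<le> n"
  shows "qbinom q (int (Suc n)) (Suc i) = qbinom q (int n) (Suc i) + q ^ (n - i) * qbinom q (int n) i"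
proof (cases "i = n")
  case True
  then show ?thesis by (simp only: qbinom_self[OF q] qbinom_gt) simp
next
  case False
  then obtain d where n: "n = Suc (i + d)"
    using i less_imp_Suc_add by (metis le_neq_implies_less)
  have d: "n - i = Suc d" "n - Suc i = d" "Suc n - Suc i = Suc d" using n by auto
  have le: "i \<le> n" "Suc i \<le> n" "Suc i \<le> Suc n" using n by auto
  have pos: "qpoch q q m \<noteq> 0" for m using qpoch_self_pos[OF q, of m] by simp
  have ne: "1 - q * q ^ m \<noteq> 0" for m
    using power_Suc_less_one[of q m] q by simp
  have frac: "A * (U + r * V) / (P * V * (D * U)) = A / (P * V * D) + r * (A / (P * (D * U)))"
    if "P \<noteq> 0" "D \<noteq> 0" "U \<noteq> 0" "V \<noteq> 0" for A P D U V r :: real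
    using that by (simp add: field_simps)
  have "q * q ^ n = (q * q ^ i) * (q * q ^ d)" unfolding n by (simp add: power_add mult_ac)
  then have *: "1 - q * q ^ n = (1 - q * q ^ d) + q ^ Suc d * (1 - q * q ^ i)"
    by (simp only: power_Suc right_diff_distrib) simp
  have "qbinom q (int (Suc n)) (Suc i) = 
     qpoch q q n * (1 - q * q ^ n) / (qpoch q q i * (1 - q * q ^ i) * (qpoch q q d * (1 - q * q ^ d)))"
    by (simp only: qbinom_int[OF le(3)] d qpoch_Suc)
  moreover have "qbinom q (int n) (Suc i) = qpoch q q n / (qpoch q q i * (1 - q * q ^ i) * qpoch q q d)"
    by (simp only: qbinom_int[OF le(2)] d qpoch_Suc)
  moreover have "qbinom q (int n) i = qpoch q q n / (qpoch q q i * (qpoch q q d * (1 - q * q ^ d)))"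
    by (simp only: qbinom_int[OF le(1)] d qpoch_Suc)
  moreover have "qpoch q q n * ((1 - q * q ^ d) + q ^ Suc d * (1 - q * q ^ i))
        / (qpoch q q i * (1 - q * q ^ i) * (qpoch q q d * (1 - q * q ^ d)))
      = qpoch q q n / (qpoch q q i * (1 - q * q ^ i) * qpoch q q d)
        + q ^ Suc d * (qpoch q q n / (qpoch q q i * (qpoch q q d * (1 - q * q ^ d))))"
    by (rule frac[OF pos pos ne ne])
  ultimately show ?thesis
    unfolding d(1) * by simp
qed

lemma qpoch_eq_sum:
  assumes q: "0 < q" "q < 1"
  shows "qpoch (- y) q n = (\<Sum>i\<le>n. qbinom q (int n) i * q ^ (i choose 2) * y ^ i)"
proof (induction n)
  case 0
  show ?case using qbinom_0[OF q, of 0] by (simp add: numeral_2_eq_2)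
next
  case (Suc n)
  let ?f = "\<lambda>m i. qbinom q (int m) i * q ^ (i choose 2) * y ^ i"
  have step: "?f (Suc n) (Suc i) = ?f n (Suc i) + y * q ^ n * ?f n i" if "i \<le> n" for i
  proof -
    have "q ^ (n - i) * q ^ (Suc i choose 2) = q ^ n * q ^ (i choose 2)"
      using that by (simp add: numeral_2_eq_2 flip: power_add)
    then show ?thesis
      unfolding qbinom_Suc[OF q that] by (simp add: algebra_simps)
  qed
  have "(\<Sum>i\<le>Suc n. ?f (Suc n) i) = ?f (Suc n) 0 + (\<Sum>i\<le>n. ?f (Suc n) (Suc i))"
    by (rule sum.atMost_Suc_shift)
  also have "(\<Sum>i\<le>n. ?f (Suc n) (Suc i)) = (\<Sum>i\<le>n. ?f n (Suc i)) + y * q ^ n * (\<Sum>i\<le>n. ?f n i)"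
    using step by (simp add: sum.distrib sum_distrib_left)
  also have "?f (Suc n) 0 = ?f n 0" by (simp only: qbinom_0[OF q])
  also have "?f n 0 + ((\<Sum>i\<le>n. ?f n (Suc i)) + y * q ^ n * (\<Sum>i\<le>n. ?f n i))
      = (\<Sum>i\<le>Suc n. ?f n i) + y * q ^ n * (\<Sum>i\<le>n. ?f n i)"
    by (simp only: sum.atMost_Suc_shift add.assoc)
  also have "(\<Sum>i\<le>Suc n. ?f n i) = (\<Sum>i\<le>n. ?f n i)"
    using qbinom_gt[of n "Suc n" q] by simp
  finally show ?case using Suc by (simp add: qpoch_Suc algebra_simps)
qed

lemma choose_two_identity:
  "((j + i) choose 2) + (j choose 2) + j = (i choose 2) + j * i + j * j"
proof (induction i)
  case 0
  show ?case by (induction j) (auto simp: numeral_2_eq_2)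
next
  case (Suc i)
  then show ?case by (simp add: numeral_2_eq_2)
qed

(* The second of the two expressions for the polynomial. *)
lemma Q_eq_qpoch_sum:
  assumes q: "0 < q" "q < 1" and x: "x \<noteq> 0" and ne: "\<And>j. j \<le> n \<Longrightarrow> qpoch (- a / x) q j \<noteq> 0"
  shows "Q q a lam n x =
    (\<Sum>j\<le>n. qbinom q (int n - int j) j * (qpoch (- a / x) q (n - j) / qpoch (- a / x) q j)
             * lam ^ j * x ^ (n - 2 * j) * q ^ (j\<^sup>2))"
  unfolding Q_def
proof (rule sum.cong[OF refl])
  fix j assume "j \<in> {..n}"
  let ?R = "qbinom q (int n - int j) j * (qpoch (- a / x) q (n - j) / qpoch (- a / x) q j)
             * lam ^ j * x ^ (n - 2 * j) * q ^ (j\<^sup>2)"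
  show "(\<Sum>k\<le>n. Q_term q a lam n x j k) = ?R"
  proof (cases "2 * j \<le> n")
    case False
    then have "Q_term q a lam n x j k = 0" for k
      by (intro Q_term_eq_0) linarith
    then show ?thesis using False by (simp add: qbinom_def)
  next
    case True
    then obtain d where n: "n = j + (j + d)" by (metis add.assoc le_Suc_ex mult_2)
    have nj: "int n - int j = int (j + d)" "n - j = j + d" "n - 2 * j = d" using n by auto
    have pos: "qpoch q q m \<noteq> 0" for m using qpoch_self_pos[OF q, of m] by simp
    have t: "Q_term q a lam n x j (j + i) = qbinom q (int (j + d)) j * lam ^ j * q ^ (j\<^sup>2) * x ^ d
          * (qbinom q (int d) i * q ^ (i choose 2) * (a * q ^ j / x) ^ i)" if i: "i \<le> d" for i
    proof -
      have b: "qbinom q (int (j + i)) j * qbinom q (int (j + d)) (j + i)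
            = qbinom q (int (j + d)) j * qbinom q (int d) i"
        using i pos by (subst (1 2 3 4) qbinom_int) (simp_all add: divide_simps)
      have e: "n - j - (j + i) = d - i" using n by simp
      have xx: "x ^ (d - i) = x ^ d / x ^ i" using i x by (simp add: power_diff)
      have qq: "q ^ (((j + i) choose 2) + (j choose 2) + j) = q ^ (i choose 2) * (q ^ j) ^ i * q ^ (j\<^sup>2)"
        unfolding choose_two_identity by (simp add: power_add power_mult power2_eq_square)
      show ?thesis
        unfolding Q_term_def nj(1) b e xx qq by (simp add: power_mult_distrib power_divide)
    qed
    have "(\<Sum>k\<le>n. Q_term q a lam n x j k) = (\<Sum>k\<in>{j..j + d}. Q_term q a lam n x j k)"
      using n by (intro sum.mono_neutral_right) (auto intro!: Q_term_eq_0)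
    also have "\<dots> = (\<Sum>i\<le>d. Q_term q a lam n x j (j + i))"
      by (rule sum.reindex_bij_witness[of _ "\<lambda>i. j + i" "\<lambda>k. k - j"]) auto
    also have "\<dots> = qbinom q (int (j + d)) j * lam ^ j * q ^ (j\<^sup>2) * x ^ d * qpoch (- (a * q ^ j / x)) q d"
      unfolding qpoch_eq_sum[OF q] sum_distrib_left by (rule sum.cong) (simp_all add: t)
    also have "qpoch (- (a * q ^ j / x)) q d = qpoch (- a / x) q (n - j) / qpoch (- a / x) q j"
      using ne[of j] n unfolding nj(2) qpoch_add by simp
    finally show ?thesis unfolding nj(1,3) by (simp add: mult_ac)
  qed
qed

end

theory Submission
  imports Defs "Jordan_Normal_Form.Determinant" "HOL-Complex_Analysis.Great_Picard"
    "HOL-Computational_Algebra.Fundamental_Theorem_Algebra"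
begin

text \<open>
  The polynomials satisfy a recurrence
  \<open>P (n + 2) = (x - b (n + 1)) P (n + 1) - c n P n\<close> with \<open>b n = - a q^n\<close> and
  \<open>c n = - \<lambda> q^(n + 1) > 0\<close>.  Positivity of the \<open>c n\<close> is what Favard's theorem asks for; that the
  measure is discrete comes from the geometric decay of both coefficients, which makes the
  tridiagonal (Jacobi) matrix of the recurrence a Hilbert-Schmidt operator.  The measure is its
  spectral measure, obtained here from the finite sections instead of from the spectral theorem.

  The eigenvalues of the \<open>N\<close>-th section are the zeros of \<open>P N\<close>.  The Christoffel-Darboux identity,
  read at a complex zero and its conjugate, shows that the zeros are real; its confluent form shows
  that they are simple; so there are \<open>N\<close> of them (\<open>jacobi_poly_card_roots\<close>).  The same identity
  says that the values of \<open>P 0, ..., P (N - 1)\<close> at the zeros form, after normalization, a matrix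
  with orthonormal rows.  Its columns are then orthonormal too, and this is a quadrature rule
  with \<open>N\<close> positive weights for which \<open>P 0, ..., P (N - 1)\<close> are orthogonal with the right norms
  (\<open>gauss_quadrature_jacobi_poly\<close>).

  It remains to let \<open>N\<close> tend to infinity without losing discreteness.  The sum of the squares of
  the nodes is the squared Hilbert-Schmidt norm of the section, hence at most
  \<open>C = \<Sum> b\<^sup>2 + 2 \<Sum> c\<close> for every \<open>N\<close> (\<open>jacobi_quadrature_square_nodes\<close>).  Listed by decreasing
  absolute value, the \<open>i\<close>-th node thus satisfies \<open>(i + 1) x\<^sup>2 \<le> C\<close>, uniformly in \<open>N\<close>.  Along a diagonal
  subsequence every node and every weight converges.  Mass can only escape to nodes of large index,
  and these are uniformly close to \<open>0\<close>; so the quadrature rules converge on continuous functions to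
  the sum of the limit atoms plus one atom at \<open>0\<close> that carries the missing mass
  (\<open>discrete_helly_selection\<close>).  For a fixed product \<open>P n P m\<close> the quadrature sums are
  eventually constant, so the limit measure has the required integrals.
\<close>

section \<open>Three-term recurrence of the q-polynomials\<close>

text \<open>
  The second q-Pascal rule, which follows from the first one by the symmetry \<open>k \<mapsto> n - k\<close>.
\<close>
lemma qbinom_Suc':
  assumes q: "0 < q" "q < 1" and i: "i \<le> n"
  shows "qbinom q (int (Suc n)) (Suc i) = q ^ Suc i * qbinom q (int n) (Suc i) + qbinom q (int n) i"
proof (cases "i = n")
  case True
  then show ?thesis using qbinom_self[OF q, of n] qbinom_self[OF q, of "Suc n"] qbinom_gt[of n "Suc n" q] by simp
next
  case False
  then have i': "i < n" using i by simp
  define m where "m = n - Suc i"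
  have m: "m \<le> n" "n - m = Suc i" "n - i = Suc m" using i' by (auto simp: m_def)
  have sym: "qbinom q (int N) k = qbinom q (int N) (N - k)" if "k \<le> N" for N k
    using that by (simp add: qbinom_int mult.commute)
  have "qbinom q (int (Suc n)) (Suc i) = qbinom q (int (Suc n)) (Suc m)"
    using sym[of "Suc i" "Suc n"] i by (simp add: m(3))
  also have "\<dots> = qbinom q (int n) (Suc m) + q ^ Suc i * qbinom q (int n) m"
    using qbinom_Suc[OF q m(1)] by (simp only: m(2))
  also have "qbinom q (int n) (Suc m) = qbinom q (int n) i"
    using sym[of i n] i by (simp only: m(3))
  also have "qbinom q (int n) m = qbinom q (int n) (Suc i)"
    using sym[of "Suc i" n] i' by (simp add: m_def)
  finally show ?thesis by simp
qed

text \<open>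
  The recurrence holds summand by summand: the term with indices \<open>j\<close>, \<open>k\<close> of \<open>Q (n + 2)\<close> comes from
  the term \<open>j\<close>, \<open>k\<close> multiplied by \<open>x\<close>, the term \<open>j\<close>, \<open>k - 1\<close> multiplied by \<open>a\<close>, and the term
  \<open>j - 1\<close>, \<open>k - 1\<close> multiplied by \<open>\<lambda>\<close>.  The first q-Pascal rule splits the binomial with lower index
  \<open>k\<close>, the second one the binomial with lower index \<open>j\<close>.  The row \<open>j = 0\<close> has no third contribution.
\<close>
lemma Q_term_j0:
  assumes q: "0 < q" "q < 1"
  shows "Q_term q a lam (Suc n) x 0 (Suc k) =
    x * Q_term q a lam n x 0 (Suc k) + a * q ^ n * Q_term q a lam n x 0 k"
proof (cases "k \<le> n")
  case True
  have e: "q ^ (n - k) * q ^ (Suc k choose 2) = q ^ n * q ^ (k choose 2)"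
    using True by (simp add: numeral_2_eq_2 flip: power_add)
  \<comment> \<open>For \<open>k = n\<close> the exponent \<open>n - Suc k\<close> is truncated, but then the binomial vanishes.\<close>
  have D: "qbinom q (int n) (Suc k) * x ^ (n - k) = qbinom q (int n) (Suc k) * (x * x ^ (n - Suc k))"
    using True by (cases "n = k") (auto simp: qbinom_gt Suc_diff_Suc simp flip: power_Suc)
  have z: "(0::nat) choose 2 = 0" by (simp add: numeral_2_eq_2)
  have "(qbinom q (int n) (Suc k) + q ^ (n - k) * qbinom q (int n) k) * (a * a ^ k) * x ^ (n - k) * q ^ (Suc k choose 2)
     = (qbinom q (int n) (Suc k) * x ^ (n - k)) * (a * a ^ k) * q ^ (Suc k choose 2)
       + (q ^ (n - k) * q ^ (Suc k choose 2)) * qbinom q (int n) k * (a * a ^ k) * x ^ (n - k)"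
    by (simp add: algebra_simps)
  then show ?thesis
    using qbinom_Suc[OF q True] qbinom_0[OF q, of k] qbinom_0[OF q, of "Suc k"]
    unfolding Q_term_def e D by (simp add: mult_ac z)
next
  case False
  then show ?thesis by (simp add: Q_term_eq_0)
qed

lemma Q_term_j_Suc:
  assumes q: "0 < q" "q < 1"
  shows "Q_term q a lam (Suc (Suc n)) x (Suc j) (Suc k) =
    x * Q_term q a lam (Suc n) x (Suc j) (Suc k) + a * q ^ Suc n * Q_term q a lam (Suc n) x (Suc j) k
      + lam * q ^ Suc n * Q_term q a lam n x j k"
proof (cases "j \<le> k \<and> j + k \<le> n")
  case True
  then obtain d e where k: "k = j + d" and n: "n = j + k + e"
    by (metis le_Suc_ex)
  define A where "A = qbinom q (int k) j"
  define B where "B = qbinom q (int k) (Suc j)"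
  define C where "C = qbinom q (int (k + e)) k"
  define D where "D = qbinom q (int (k + e)) (Suc k)"
  have kS: "qbinom q (int (Suc k)) (Suc j) = q ^ Suc j * B + A"
    unfolding A_def B_def using qbinom_Suc'[OF q, of j k] k by simp
  have nS: "qbinom q (int (Suc (k + e))) (Suc k) = D + q ^ e * C"
    unfolding C_def D_def using qbinom_Suc[OF q, of k "k + e"] by simp
  have i: "int (Suc (Suc n)) - int (Suc j) = int (Suc (k + e))"
    "int (Suc n) - int (Suc j) = int (k + e)" "int n - int j = int (k + e)"
    using n by auto
  \<comment> \<open>If \<open>e = 0\<close>, the exponent \<open>e - 1\<close> is truncated, but \<open>D = 0\<close>; likewise for \<open>d\<close> and \<open>B\<close>.\<close>
  have D0: "x ^ e * D = x * x ^ (e - 1) * D"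
    by (cases e) (auto simp: D_def qbinom_gt)
  have B0: "a ^ d * B = a * a ^ (d - 1) * B"
    using k by (cases d) (auto simp: B_def qbinom_gt)
  have ex: "Suc k - Suc j = d" "k - Suc j = d - 1" "k - j = d" 
    "Suc (Suc n) - Suc j - Suc k = e" "Suc n - Suc j - Suc k = e - 1"
    "Suc n - Suc j - k = e" "n - j - k = e"
    using n k by auto
  define c where "c = (k choose 2) + (j choose 2) + j"
  have c1: "(Suc k choose 2) + (Suc j choose 2) + Suc j = c + k + j + 1"
    "(k choose 2) + (Suc j choose 2) + Suc j = c + j + 1"
    by (simp_all add: c_def numeral_2_eq_2)
  have "Q_term q a lam (Suc (Suc n)) x (Suc j) (Suc k) =
     (q ^ Suc j * B + A) * (D + q ^ e * C) * a ^ d * x ^ e * lam ^ Suc j * q ^ (c + k + j + 1)"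
    unfolding Q_term_def i ex kS nS c1 ..
  moreover have "Q_term q a lam (Suc n) x (Suc j) (Suc k) =
     (q ^ Suc j * B + A) * D * a ^ d * x ^ (e - 1) * lam ^ Suc j * q ^ (c + k + j + 1)"
    unfolding Q_term_def i ex kS D_def c1 ..
  moreover have "Q_term q a lam (Suc n) x (Suc j) k =
     B * C * a ^ (d - 1) * x ^ e * lam ^ Suc j * q ^ (c + j + 1)"
    unfolding Q_term_def i ex B_def C_def c1 ..
  moreover have "Q_term q a lam n x j k = A * C * a ^ d * x ^ e * lam ^ j * q ^ c"
    unfolding Q_term_def i ex A_def C_def c_def ..
  moreover have "(q ^ Suc j * B + A) * (D + q ^ e * C) * a ^ d * x ^ e * lam ^ Suc j * q ^ (c + k + j + 1)
     = (q ^ Suc j * B + A) * (x ^ e * D) * a ^ d * lam ^ Suc j * q ^ (c + k + j + 1)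
      + q ^ (e + Suc j + c + k + j + 1) * (a ^ d * B) * C * x ^ e * lam ^ Suc j
      + q ^ (e + c + k + j + 1) * A * C * a ^ d * x ^ e * lam ^ Suc j"
    by (simp add: algebra_simps power_add)
  moreover have "n = j + j + d + e" using n k by simp
  ultimately show ?thesis
    unfolding D0 B0 by (simp add: algebra_simps power_add k)
next
  case False
  then have "\<not> (Suc j \<le> Suc k \<and> Suc j + Suc k \<le> Suc (Suc n))"
    "\<not> (Suc j \<le> Suc k \<and> Suc j + Suc k \<le> Suc n)"
    "\<not> (Suc j \<le> k \<and> Suc j + k \<le> Suc n)" by auto
  with False show ?thesis
    using Q_term_eq_0 by (metis (no_types, lifting) add_cancel_right_right linorder_not_le mult_zero_right)
qed

text \<open>
  All polynomials in the recurrence have to be written as sums over one common range of indices.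
\<close>
lemma Q_eq_sum_atMost:
  assumes "n \<le> N"
  shows "Q q a lam n x = (\<Sum>j\<le>N. \<Sum>k\<le>N. Q_term q a lam n x j k)"
proof -
  have "(\<Sum>k\<le>N. Q_term q a lam n x j k) = (\<Sum>k\<le>n. Q_term q a lam n x j k)" for j
    using assms by (intro sum.mono_neutral_right) (auto intro!: Q_term_eq_0)
  moreover have "(\<Sum>j\<le>N. \<Sum>k\<le>n. Q_term q a lam n x j k) = Q q a lam n x"
    unfolding Q_def using assms
    by (intro sum.mono_neutral_right) (auto intro!: Q_term_eq_0 sum.neutral)
  ultimately show ?thesis by simp
qed

lemma Q_0: 
  assumes q: "0 < q" "q < 1"
  shows "Q q a lam 0 x = 1"
  using qbinom_0[OF q, of 0] by (simp add: Q_def Q_term_def numeral_2_eq_2)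

lemma Q_Suc_0:
  assumes q: "0 < q" "q < 1"
  shows "Q q a lam (Suc 0) x = x + a"
  using qbinom_0[OF q, of 0] qbinom_0[OF q, of 1] qbinom_self[OF q, of 1]
  by (simp add: Q_def Q_term_eq_0 Q_term_def[of _ _ _ _ _ 0 0] Q_term_def[of _ _ _ _ _ 0 "Suc 0"] numeral_2_eq_2)

lemma Q_recurrence:
  assumes q: "0 < q" "q < 1"
  shows "Q q a lam (Suc (Suc n)) x =
    (x + a * q ^ Suc n) * Q q a lam (Suc n) x + lam * q ^ Suc n * Q q a lam n x"
proof -
  let ?t = "Q_term q a lam" and ?N = "Suc (Suc n)"
  have k0: "?t (Suc m) x j 0 = x * ?t m x j 0" for m j
    using qbinom_0[OF q, of m] qbinom_0[OF q, of "Suc m"]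
    by (cases "j = 0") (simp_all add: Q_term_eq_0, simp add: Q_term_def)
  \<comment> \<open>The row sums of \<open>Q n\<close>, shifted by one row.\<close>
  define r where "r j = (if j = 0 then 0 else \<Sum>k\<le>Suc n. ?t n x (j - 1) k)" for j
  have row: "(\<Sum>k\<le>?N. ?t ?N x j k) = x * (\<Sum>k\<le>?N. ?t (Suc n) x j k)
      + a * q ^ Suc n * (\<Sum>k\<le>Suc n. ?t (Suc n) x j k) + lam * q ^ Suc n * r j" for j
  proof (cases j)
    case 0
    then show ?thesis
      by (simp only: sum.atMost_Suc_shift[of _ "Suc n"] k0 Q_term_j0[OF q] r_def)
         (simp add: sum.distrib sum_distrib_left algebra_simps del: sum.atMost_Suc)
  next
    case (Suc i)
    then show ?thesis
      by (simp only: sum.atMost_Suc_shift[of _ "Suc n"] k0 Q_term_j_Suc[OF q] r_def)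
         (simp add: sum.distrib sum_distrib_left algebra_simps del: sum.atMost_Suc)
  qed
  have "(\<Sum>k\<le>?N. ?t (Suc n) x j k) = (\<Sum>k\<le>Suc n. ?t (Suc n) x j k)" for j
    by (simp add: Q_term_eq_0)
  then have row': "(\<Sum>k\<le>?N. ?t ?N x j k) = (x + a * q ^ Suc n) * (\<Sum>k\<le>?N. ?t (Suc n) x j k)
      + lam * q ^ Suc n * r j" for j
    unfolding row by (simp add: algebra_simps del: sum.atMost_Suc)
  have "(\<Sum>j\<le>?N. r j) = Q q a lam n x"
    unfolding sum.atMost_Suc_shift[of _ "Suc n"] Q_eq_sum_atMost[OF le_SucI, OF order_refl]
    by (simp add: r_def del: sum.atMost_Suc)
  then show ?thesis
    unfolding Q_eq_sum_atMost[OF order_refl, of _ _ _ ?N] row'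
      Q_eq_sum_atMost[OF le_SucI, OF order_refl, of _ _ _ "Suc n"]
    by (simp add: sum.distrib del: sum.atMost_Suc flip: sum_distrib_left)
qed

section \<open>Zeros of polynomials given by a Jacobi recurrence\<close>

text \<open>
  The coefficients are real, but the polynomials are needed over the complex numbers as well: the
  fundamental theorem of algebra provides the zeros there.  The index of \<open>c\<close> is shifted so that
  the squared norm of the \<open>n\<close>-th polynomial is \<open>\<Prod>i<n. c i\<close>.
\<close>
fun jacobi_poly :: "(nat \<Rightarrow> real) \<Rightarrow> (nat \<Rightarrow> real) \<Rightarrow> nat \<Rightarrow> 'a::real_normed_field poly" where
  "jacobi_poly b c 0 = 1"
| "jacobi_poly b c (Suc 0) = [:- of_real (b 0), 1:]"
| "jacobi_poly b c (Suc (Suc n)) =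
     [:- of_real (b (Suc n)), 1:] * jacobi_poly b c (Suc n) - Polynomial.smult (of_real (c n)) (jacobi_poly b c n)"

lemma poly_jacobi_poly_Suc_Suc:
  "poly (jacobi_poly b c (Suc (Suc n))) x =
     (x - of_real (b (Suc n))) * poly (jacobi_poly b c (Suc n)) x - of_real (c n) * poly (jacobi_poly b c n) x"
  by (simp add: algebra_simps)

lemma poly_jacobi_poly_of_real:
  "poly (jacobi_poly b c n) (of_real x :: complex) = of_real (poly (jacobi_poly b c n) x)"
  by (induction b c n rule: jacobi_poly.induct) (auto simp: algebra_simps)

lemma poly_jacobi_poly_cnj:
  "poly (jacobi_poly b c n) (cnj z) = cnj (poly (jacobi_poly b c n) z)"
  by (induction b c n rule: jacobi_poly.induct) (auto simp: algebra_simps)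

lemma monic_jacobi_poly:
  "degree (jacobi_poly b c n :: 'a::real_normed_field poly) = n \<and> lead_coeff (jacobi_poly b c n :: 'a poly) = 1"
proof (induction b c n rule: jacobi_poly.induct)
  case (3 b c n)
  let ?P = "jacobi_poly b c :: nat \<Rightarrow> 'a poly"
  let ?L = "[:- of_real (b (Suc n)), 1:] :: 'a poly"
  have P: "degree (?P (Suc n)) = Suc n" "lead_coeff (?P (Suc n)) = 1" "degree (?P n) = n"
    using 3 by blast+
  have "?P (Suc n) \<noteq> 0" using P(2) by (metis leading_coeff_0_iff zero_neq_one)
  then have d: "degree (?L * ?P (Suc n)) = Suc (Suc n)"
    by (subst degree_mult_eq) (simp_all add: P(1))
  have l: "lead_coeff (?L * ?P (Suc n)) = 1"
    unfolding lead_coeff_mult P(2) by simp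
  have s: "degree (- Polynomial.smult (of_real (c n)) (?P n)) < degree (?L * ?P (Suc n))"
    unfolding d using P(3) degree_smult_le[of "of_real (c n)" "?P n"] by simp
  have "?P (Suc (Suc n)) = - Polynomial.smult (of_real (c n)) (?P n) + ?L * ?P (Suc n)" by simp
  then show ?case
    using degree_add_eq_right[OF s] lead_coeff_add_le[OF s] d l by (simp only:)
qed auto

text \<open>
  The Christoffel-Darboux identity: the recurrence makes the sum telescope.
\<close>
lemma christoffel_darboux:
  fixes x y :: "'a::real_normed_field"
  assumes c: "\<And>n. c n > 0"
  shows "(x - y) * (\<Sum>k\<le>n. poly (jacobi_poly b c k) x * poly (jacobi_poly b c k) y / of_real (\<Prod>i<k. c i))
    = (poly (jacobi_poly b c (Suc n)) x * poly (jacobi_poly b c n) y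
        - poly (jacobi_poly b c n) x * poly (jacobi_poly b c (Suc n)) y) / of_real (\<Prod>i<n. c i)"
proof (induction n)
  case 0
  show ?case by simp
next
  case (Suc n)
  define h :: 'a where "h = of_real (\<Prod>i<n. c i)"
  define d :: 'a where "d = of_real (c n)"
  have "(\<Prod>i<n. c i) \<noteq> 0" "c n \<noteq> 0" using c by (simp_all add: less_imp_neq[symmetric])
  then have h: "h \<noteq> 0" "d \<noteq> 0" using c[of n] unfolding h_def d_def by simp_all
  have h': "of_real (\<Prod>i<Suc n. c i) = h * d" by (simp add: h_def d_def)
  show ?case
    unfolding sum.atMost_Suc distrib_left Suc.IH poly_jacobi_poly_Suc_Suc h' h_def[symmetric] d_def[symmetric]
    using h by (simp add: divide_simps) (simp add: algebra_simps)
qed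

text \<open>
  The confluent case \<open>y \<longlongrightarrow> x\<close>, again by telescoping.
\<close>
lemma christoffel_darboux_deriv:
  fixes x :: "'a::real_normed_field"
  assumes c: "\<And>n. c n > 0"
  shows "(\<Sum>k\<le>n. (poly (jacobi_poly b c k) x)\<^sup>2 / of_real (\<Prod>i<k. c i))
    = (poly (pderiv (jacobi_poly b c (Suc n))) x * poly (jacobi_poly b c n) x
        - poly (pderiv (jacobi_poly b c n)) x * poly (jacobi_poly b c (Suc n)) x) / of_real (\<Prod>i<n. c i)"
proof (induction n)
  case 0
  show ?case by (simp add: pderiv_pCons)
next
  case (Suc n)
  define h :: 'a where "h = of_real (\<Prod>i<n. c i)"
  define d :: 'a where "d = of_real (c n)"
  have "(\<Prod>i<n. c i) \<noteq> 0" "c n \<noteq> 0" using c by (simp_all add: less_imp_neq[symmetric])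
  then have h: "h \<noteq> 0" "d \<noteq> 0" using c[of n] unfolding h_def d_def by simp_all
  have h': "of_real (\<Prod>i<Suc n. c i) = h * d" by (simp add: h_def d_def)
  have dd: "poly (pderiv (jacobi_poly b c (Suc (Suc n)))) x = poly (jacobi_poly b c (Suc n)) x
     + (x - of_real (b (Suc n))) * poly (pderiv (jacobi_poly b c (Suc n))) x - d * poly (pderiv (jacobi_poly b c n)) x"
    unfolding jacobi_poly.simps pderiv_diff pderiv_mult pderiv_smult by (simp add: pderiv_pCons algebra_simps d_def)
  have alg: "(r' * p - p' * r) / h + r\<^sup>2 / (h * d) = ((r + y * r' - d * p') * r - r' * (y * r - d * p)) / (h * d)"
    for p p' r r' y :: 'a
    using h by (simp add: field_simps power2_eq_square)
  show ?case
    unfolding sum.atMost_Suc Suc.IH dd poly_jacobi_poly_Suc_Suc h' h_def[symmetric] d_def[symmetric]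
    by (rule alg)
qed

text \<open>
  Applied to \<open>f k = P k x\<close>, where \<open>f 0 = 1\<close>, this keeps the Christoffel-Darboux sums away from \<open>0\<close>.
\<close>
lemma sum_squares_divide_prod_ge_first:
  fixes c f :: "nat \<Rightarrow> real"
  assumes c: "\<And>n. c n > 0"
  shows "(\<Sum>k\<le>n. (f k)\<^sup>2 / (\<Prod>i<k. c i)) \<ge> (f 0)\<^sup>2"
proof -
  have p: "(\<Prod>i<k. c i) > 0" for k using c by (simp add: prod_pos)
  have "(f 0)\<^sup>2 = (\<Sum>k\<in>{0}. (f k)\<^sup>2 / (\<Prod>i<k. c i))" by simp
  also have "\<dots> \<le> (\<Sum>k\<le>n. (f k)\<^sup>2 / (\<Prod>i<k. c i))"
    using p by (intro sum_mono2) (auto intro!: divide_nonneg_pos)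
  finally show ?thesis .
qed

text \<open>
  At a zero \<open>z\<close> and its conjugate the right-hand side of the Christoffel-Darboux identity vanishes,
  while the sum on the left is positive; so the factor \<open>z - cnj z\<close> is \<open>0\<close>.
\<close>
lemma jacobi_poly_root_real:
  assumes c: "\<And>n. c n > 0" and z: "poly (jacobi_poly b c (Suc n)) (z::complex) = 0"
  shows "z \<in> \<real>"
proof -
  let ?P = "jacobi_poly b c :: nat \<Rightarrow> complex poly"
  have "(z - cnj z) * (\<Sum>k\<le>n. poly (?P k) z * poly (?P k) (cnj z) / of_real (\<Prod>i<k. c i)) = 0"
    unfolding christoffel_darboux[where c = c, OF c] by (simp add: poly_jacobi_poly_cnj z)
  also have "(\<Sum>k\<le>n. poly (?P k) z * poly (?P k) (cnj z) / of_real (\<Prod>i<k. c i))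
    = of_real (\<Sum>k\<le>n. (cmod (poly (?P k) z))\<^sup>2 / (\<Prod>i<k. c i))"
    by (simp add: poly_jacobi_poly_cnj flip: complex_norm_square)
  finally have "z - cnj z = 0"
    using sum_squares_divide_prod_ge_first[where c = c and n = n and f = "\<lambda>k. cmod (poly (?P k) z)", OF c]
    by (simp del: of_real_sum of_real_divide of_real_prod)
  then show ?thesis by (simp add: Reals_cnj_iff)
qed

text \<open>
  A double zero would make the right-hand side of the confluent identity vanish.  So the complex
  polynomial is squarefree and has as many zeros as its degree says, all of them real.
\<close>
lemma jacobi_poly_card_roots:
  assumes c: "\<And>n. c n > 0"
  shows "finite {x::real. poly (jacobi_poly b c n) x = 0} \<and> card {x::real. poly (jacobi_poly b c n) x = 0} = n"
proof (cases n)
  case 0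
  then show ?thesis by simp
next
  case (Suc m)
  let ?P = "jacobi_poly b c :: nat \<Rightarrow> complex poly"
  let ?R = "{x::real. poly (jacobi_poly b c n) x = 0}"
  have roots: "{z. poly (?P n) z = 0} = of_real ` ?R"
  proof (intro equalityI subsetI)
    fix z assume "z \<in> {z. poly (?P n) z = 0}"
    moreover from this obtain x where "z = of_real x"
      using jacobi_poly_root_real[where c = c and b = b and n = m, OF c] 
      unfolding Suc by (auto elim!: Reals_cases)
    ultimately show "z \<in> of_real ` ?R"
      by (simp add: poly_jacobi_poly_of_real)
  qed (auto simp: poly_jacobi_poly_of_real)
  have nz: "?P n \<noteq> 0"
    using monic_jacobi_poly[of b c n, where ?'a = complex] by auto
  have "rsquarefree (?P n)"
    unfolding rsquarefree_roots
  proof (intro allI notI)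
    fix z assume z: "poly (?P n) z = 0 \<and> poly (pderiv (?P n)) z = 0"
    then obtain x where x: "z = of_real x" 
      using roots by auto
    have "complex_of_real (\<Sum>k\<le>m. (poly (jacobi_poly b c k) x)\<^sup>2 / (\<Prod>i<k. c i)) = 0"
      using christoffel_darboux_deriv[where c = c and b = b and x = z and n = m, OF c] z unfolding Suc x
      by (simp add: poly_jacobi_poly_of_real del: jacobi_poly.simps)
    then show False
      using sum_squares_divide_prod_ge_first[where c = c and n = m and f = "\<lambda>k. poly (jacobi_poly b c k) x", OF c]
      by (simp del: of_real_sum of_real_divide of_real_prod)
  qed
  then have "?P n = Polynomial.smult (lead_coeff (?P n)) (\<Prod>z|poly (?P n) z = 0. [:-z, 1:])"
    by (rule complex_poly_decompose_rsquarefree[symmetric])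
  then have "degree (?P n) = degree (\<Prod>z|poly (?P n) z = 0. [:-z, 1:])"
    using nz by (metis degree_smult_eq leading_coeff_0_iff)
  also have "\<dots> = card {z. poly (?P n) z = 0}"
    by (subst degree_prod_eq_sum_degree) auto
  also have "\<dots> = card ?R"
    unfolding roots by (intro card_image) (auto simp: inj_on_def)
  finally have "card ?R = n" using monic_jacobi_poly[of b c n, where ?'a = complex] by simp
  then show ?thesis using Suc by (metis card.infinite nat.distinct(1))
qed

section \<open>Gauss quadrature at the zeros\<close>

text \<open>
  The nodes are the zeros of \<open>P N\<close>, the weights the reciprocals of the Christoffel-Darboux sums \<open>K\<close>
  on the diagonal.  The identity gives \<open>A B = 1\<close> for the square matrices with entries
  \<open>w i * P k (x i)\<close> and \<open>P k (x j) / h k\<close>; the orthogonality relations are the entries of \<open>B A = 1\<close>.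
  The order of the nodes is chosen with a view to the bound on single nodes that the
  sum of squares gives.
\<close>
lemma gauss_quadrature_jacobi_poly:
  fixes b c :: "nat \<Rightarrow> real"
  assumes c: "\<And>n. c n > 0"
  obtains x w :: "nat \<Rightarrow> real" where
    "\<And>i. i < N \<Longrightarrow> poly (jacobi_poly b c N) (x i) = 0"
    "\<And>i j. i \<le> j \<Longrightarrow> j < N \<Longrightarrow> \<bar>x j\<bar> \<le> \<bar>x i\<bar>"
    "\<And>i. w i > 0"
    "\<And>i. i < N \<Longrightarrow> w i * (\<Sum>k<N. (poly (jacobi_poly b c k) (x i))\<^sup>2 / (\<Prod>i<k. c i)) = 1"
    "\<And>k l. k < N \<Longrightarrow> l < N \<Longrightarrow>
       (\<Sum>i<N. w i * (poly (jacobi_poly b c k) (x i) * poly (jacobi_poly b c l) (x i)))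
         = (if k = l then \<Prod>i<k. c i else 0)"
proof (cases N)
  case 0
  show ?thesis by (rule that[of "\<lambda>_. 0" "\<lambda>_. 1"]) (use 0 in auto)
next
  case (Suc m)
  let ?P = "jacobi_poly b c :: nat \<Rightarrow> real poly"
  define h where "h k = (\<Prod>i<k. c i)" for k
  have h: "h k > 0" for k unfolding h_def using c by (simp add: prod_pos)
  define R where "R = {x. poly (?P N) x = 0}"
  have R: "finite R" "card R = N" using jacobi_poly_card_roots[where b = b and c = c, OF c] unfolding R_def by auto
  define xs where "xs = sort_key (\<lambda>x. - \<bar>x\<bar>) (sorted_list_of_set R)"
  have xs: "set xs = R" "length xs = N" "distinct xs" "sorted (map (\<lambda>x. - \<bar>x\<bar>) xs)"
    using R by (simp_all add: xs_def)
  define x where "x i = xs ! i" for i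
  define K where "K y z = (\<Sum>k<N. poly (?P k) y * poly (?P k) z / h k)" for y z
  define w where "w i = 1 / K (x i) (x i)" for i
  have root: "poly (?P N) (x i) = 0" if "i < N" for i
    using that xs(1,2) nth_mem[of i xs] by (auto simp: x_def R_def)
  have K_pos: "K y y > 0" for y
    using sum_squares_divide_prod_ge_first[where c = c and f = "\<lambda>k. poly (?P k) y" and n = m, OF c]
    unfolding K_def Suc lessThan_Suc_atMost h_def by (simp add: power2_eq_square)
  have K_0: "K (x i) (x j) = 0" if "i < N" "j < N" "i \<noteq> j" for i j
  proof -
    have "(x i - x j) * K (x i) (x j) = 0"
      using christoffel_darboux[where b = b and c = c and n = m and x = "x i" and y = "x j", OF c] root[OF that(1)] root[OF that(2)]
      unfolding K_def Suc lessThan_Suc_atMost h_def by (simp del: jacobi_poly.simps)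
    moreover have "x i \<noteq> x j" using that xs(2,3) by (simp add: x_def nth_eq_iff_index_eq)
    ultimately show ?thesis by simp
  qed
  define A where "A = Matrix.mat N N (\<lambda>(i, k). w i * poly (?P k) (x i))"
  define B where "B = Matrix.mat N N (\<lambda>(k, j). poly (?P k) (x j) / h k)"
  have AB: "A \<in> carrier_mat N N" "B \<in> carrier_mat N N" by (simp_all add: A_def B_def)
  have "A * B = 1\<^sub>m N"
  proof (rule eq_matI)
    fix i j assume "i < dim_row (1\<^sub>m N)" "j < dim_col (1\<^sub>m N)"
    then have ij: "i < N" "j < N" by simp_all
    have "(A * B) $$ (i, j) = (\<Sum>k<N. w i * poly (?P k) (x i) * (poly (?P k) (x j) / h k))"
      using ij by (simp add: A_def B_def scalar_prod_def atLeast0LessThan)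
    also have "\<dots> = w i * K (x i) (x j)" 
      unfolding K_def sum_distrib_left by (rule sum.cong) (simp_all add: mult_ac)
    also have "\<dots> = (1\<^sub>m N) $$ (i, j)"
      using ij K_0[OF ij] K_pos[of "x j"] by (auto simp: w_def)
    finally show "(A * B) $$ (i, j) = (1\<^sub>m N) $$ (i, j)" .
  qed (use AB in auto)
  then have BA: "B * A = 1\<^sub>m N" by (rule mat_mult_left_right_inverse[OF AB])
  have orth: "(\<Sum>i<N. w i * (poly (?P k) (x i) * poly (?P l) (x i))) = (if k = l then h k else 0)"
    if kl: "k < N" "l < N" for k l
  proof -
    have "(B * A) $$ (k, l) = (\<Sum>i<N. poly (?P k) (x i) / h k * (w i * poly (?P l) (x i)))"
      using kl by (simp add: A_def B_def scalar_prod_def atLeast0LessThan)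
    also have "\<dots> = (\<Sum>i<N. w i * (poly (?P k) (x i) * poly (?P l) (x i))) / h k"
      unfolding sum_divide_distrib by (rule sum.cong) (simp_all add: mult_ac)
    finally show ?thesis
      using h[of k] kl unfolding BA by (simp add: field_simps split: if_splits)
  qed
  have desc: "\<bar>x j\<bar> \<le> \<bar>x i\<bar>" if "i \<le> j" "j < N" for i j
    using sorted_nth_mono[OF xs(4), of i j] that xs(2) by (simp add: x_def)
  have w_pos: "w i > 0" and norm: "w i * (\<Sum>k<N. (poly (?P k) (x i))\<^sup>2 / h k) = 1" for i
    using K_pos[of "x i"] unfolding w_def by (simp_all add: K_def power2_eq_square)
  show ?thesis
    by (rule that[OF root desc w_pos norm[unfolded h_def] orth[unfolded h_def]])
qed

text \<open>
  The left-hand side is the trace of the square of the truncated symmetric Jacobi matrix.  It is computed by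
  inserting the normalization of the weights and expanding \<open>x P k\<close> by the recurrence: column \<open>k\<close>
  contributes its sum of squares \<open>c k + (b k)\<^sup>2 + c (k - 1)\<close>, with the first summand missing in
  the last column because \<open>P N\<close> vanishes at the nodes.
\<close>
lemma jacobi_quadrature_square_nodes:
  fixes b c x w :: "nat \<Rightarrow> real"
  assumes c: "\<And>n. c n > 0"
    and sum_b: "summable (\<lambda>n. (b n)\<^sup>2)" and sum_c: "summable c"
    and root: "\<And>i. i < N \<Longrightarrow> poly (jacobi_poly b c N) (x i) = 0"
    and w: "\<And>i. i < N \<Longrightarrow> w i * (\<Sum>k<N. (poly (jacobi_poly b c k) (x i))\<^sup>2 / (\<Prod>i<k. c i)) = 1"
    and orth: "\<And>k l. k < N \<Longrightarrow> l < N \<Longrightarrow>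
       (\<Sum>i<N. w i * (poly (jacobi_poly b c k) (x i) * poly (jacobi_poly b c l) (x i)))
         = (if k = l then \<Prod>i<k. c i else 0)"
  shows "(\<Sum>i<N. (x i)\<^sup>2) \<le> (\<Sum>n. (b n)\<^sup>2) + 2 * (\<Sum>n. c n)"
proof -
  let ?p = "\<lambda>k i. poly (jacobi_poly b c k) (x i)"
  define h where "h k = (\<Prod>i<k. c i)" for k
  have h: "h k > 0" for k unfolding h_def using c by (simp add: prod_pos)
  have hS: "h (Suc k) = h k * c k" for k by (simp add: h_def)
  define T where "T f = (\<Sum>i<N. w i * f i)" for f
  have T_add: "T (\<lambda>i. f i + g i) = T f + T g" for f g
    by (simp add: T_def sum.distrib algebra_simps)
  have T_mult: "T (\<lambda>i. r * f i) = r * T f" for f r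
    by (simp add: T_def sum_distrib_left algebra_simps)
  have ort: "T (\<lambda>i. ?p k i * ?p l i) = (if k = l \<and> k < N then h k else 0)" if "k \<le> N" "l \<le> N" for k l
  proof (cases "k < N \<and> l < N")
    case True
    then show ?thesis using orth[of k l] by (simp add: T_def h_def)
  next
    case False
    then have "w i * (?p k i * ?p l i) = 0" if "i < N" for i
      using root[OF that] \<open>k \<le> N\<close> \<open>l \<le> N\<close> by (auto simp: not_less)
    then have "T (\<lambda>i. ?p k i * ?p l i) = 0"
      unfolding T_def by (intro sum.neutral) auto
    then show ?thesis using False \<open>k \<le> N\<close> \<open>l \<le> N\<close> by auto
  qed
  define g where "g k = c k + (b k)\<^sup>2 + (if k = 0 then 0 else c (k - 1))" for k
  have col: "T (\<lambda>i. (x i * ?p k i)\<^sup>2) / h k \<le> g k" if "k < N" for k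
  proof (cases k)
    case 0
    have "(x i * ?p 0 i)\<^sup>2 = ?p 1 i * ?p 1 i + (2 * b 0 * (?p 0 i * ?p 1 i) + (b 0)\<^sup>2 * (?p 0 i * ?p 0 i))" for i
      by (simp add: power2_eq_square algebra_simps)
    then have "T (\<lambda>i. (x i * ?p 0 i)\<^sup>2) = (if 1 < N then h 1 else 0) + (b 0)\<^sup>2 * h 0"
      unfolding T_add T_mult using that 0 by (simp add: ort T_add T_mult del: jacobi_poly.simps)
    then show ?thesis using 0 h[of 1] by (simp add: g_def h_def)
  next
    case (Suc l)
    have rec: "x i * ?p (Suc l) i = ?p (Suc (Suc l)) i + b (Suc l) * ?p (Suc l) i + c l * ?p l i" for i
      unfolding poly_jacobi_poly_Suc_Suc by (simp add: algebra_simps)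
    have "(x i * ?p (Suc l) i)\<^sup>2 = ?p (Suc (Suc l)) i * ?p (Suc (Suc l)) i
      + ((b (Suc l))\<^sup>2 * (?p (Suc l) i * ?p (Suc l) i)
      + ((c l)\<^sup>2 * (?p l i * ?p l i)
      + (2 * b (Suc l) * (?p (Suc (Suc l)) i * ?p (Suc l) i) 
      + (2 * c l * (?p (Suc (Suc l)) i * ?p l i)
      + 2 * b (Suc l) * c l * (?p (Suc l) i * ?p l i)))))" for i
      unfolding rec by (simp add: power2_eq_square algebra_simps del: jacobi_poly.simps)
    then have "T (\<lambda>i. (x i * ?p (Suc l) i)\<^sup>2) 
        = (if Suc (Suc l) < N then h (Suc (Suc l)) else 0) + (b (Suc l))\<^sup>2 * h (Suc l) + (c l)\<^sup>2 * h l"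
      using that Suc by (simp add: ort T_add T_mult del: jacobi_poly.simps)
    also have "\<dots> \<le> g k * h k"
      using Suc h[of "Suc (Suc l)"] by (simp add: g_def hS algebra_simps power2_eq_square)
    finally show ?thesis using Suc h[of k] by (simp add: pos_divide_le_eq)
  qed
  have "(\<Sum>i<N. (x i)\<^sup>2) = (\<Sum>i<N. (x i)\<^sup>2 * (w i * (\<Sum>k<N. (?p k i)\<^sup>2 / h k)))"
    using w by (simp add: h_def)
  also have "\<dots> = (\<Sum>k<N. T (\<lambda>i. (x i * ?p k i)\<^sup>2) / h k)"
    unfolding T_def sum_distrib_left sum_divide_distrib
    by (subst sum.swap) (simp add: power_mult_distrib mult_ac)
  also have "\<dots> \<le> (\<Sum>k<N. g k)"
    using col by (intro sum_mono) auto
  also have "(\<Sum>k<N. g k) = (\<Sum>k<N. c k) + (\<Sum>k<N. (b k)\<^sup>2) + (\<Sum>k<N. if k = 0 then 0 else c (k - 1))"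
    by (simp add: g_def sum.distrib)
  also have "(\<Sum>k<N. if k = 0 then 0 else c (k - 1)) = (\<Sum>k<N - 1. c k)"
    by (cases N) (simp_all add: sum.lessThan_Suc_shift del: sum.lessThan_Suc)
  also have "(\<Sum>k<N - 1. c k) \<le> (\<Sum>n. c n)"
    using c by (intro sum_le_suminf sum_c) (auto intro: less_imp_le)
  also have "(\<Sum>k<N. c k) \<le> (\<Sum>n. c n)"
    using c by (intro sum_le_suminf sum_c) (auto intro: less_imp_le)
  also have "(\<Sum>k<N. (b k)\<^sup>2) \<le> (\<Sum>n. (b n)\<^sup>2)"
    by (intro sum_le_suminf sum_b) auto
  finally show ?thesis by simp
qed

section \<open>Compactness for discrete measures with uniformly decaying atoms\<close>

text \<open>
  Here \<open>w n i\<close> is the mass of the \<open>n\<close>-th measure at its \<open>i\<close>-th atom \<open>x n i\<close>.  The bound on the atoms does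
  not depend on \<open>n\<close>, so the atoms of large index lie near \<open>0\<close>, for all \<open>n\<close> simultaneously.
  A function that vanishes at \<open>0\<close> is therefore integrated by the first \<open>m\<close> atoms up to an error
  that tends to \<open>0\<close> with \<open>m\<close> uniformly in \<open>n\<close>, and the two limits may be interchanged.
  Constants are taken care of by the atom at \<open>0\<close> that restores the total mass \<open>1\<close>.
\<close>
lemma discrete_helly_selection:
  fixes x w :: "nat \<Rightarrow> nat \<Rightarrow> real"
  assumes w_nonneg: "\<And>n i. w n i \<ge> 0" and w_0: "\<And>n i. i \<ge> n \<Longrightarrow> w n i = 0"
    and w_sum: "\<And>n. n > 0 \<Longrightarrow> (\<Sum>i<n. w n i) = 1"
    and x: "\<And>n i. real (Suc i) * (x n i)\<^sup>2 \<le> C"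
  obtains r :: "nat \<Rightarrow> nat" and V Y :: "nat \<Rightarrow> real" where "strict_mono r"
    "\<And>i. V i \<ge> 0" "summable V" "\<And>i. \<bar>Y i\<bar> \<le> sqrt C"
    "\<And>f :: real \<Rightarrow> real. continuous_on UNIV f \<Longrightarrow>
       (\<lambda>n. \<Sum>i<r n. w (r n) i * f (x (r n) i)) \<longlonglongrightarrow> (\<Sum>i. V i * f (Y i))"
proof -
  have x_le: "\<bar>x n i\<bar> \<le> sqrt (C / real (Suc i))" for n i
    using x[of i n] by (intro real_le_rsqrt) (simp add: field_simps)
  have C: "C \<ge> 0" using x[of 0 0] by (smt (verit) mult_nonneg_nonneg of_nat_0_le_iff zero_le_power2)
  have x_le': "\<bar>x n i\<bar> \<le> sqrt C" for n i
  proof -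
    have "C / real (Suc i) \<le> C / 1" using C by (intro divide_left_mono) auto
    then show ?thesis using x_le[of n i] by (smt (verit) real_sqrt_le_iff div_by_1)
  qed
  have w_partial: "(\<Sum>i\<in>A. w n i) \<le> 1" if "finite A" for A n
  proof -
    have "(\<Sum>i\<in>A. w n i) = (\<Sum>i\<in>A \<inter> {..<n}. w n i)"
      using that w_0[of n] by (intro sum.mono_neutral_right) (auto simp: not_less[symmetric])
    also have "\<dots> \<le> (\<Sum>i<n. w n i)"
      using w_nonneg by (intro sum_mono2) auto
    also have "\<dots> \<le> 1" using w_sum[of n] by (cases "n = 0") auto
    finally show ?thesis .
  qed
  have "norm (x n i, w n i) \<le> sqrt C + 1" for n i
    using norm_Pair_le[of "x n i" "w n i"] x_le'[of n i] w_nonneg[of n i] w_partial[of "{i}" n] by simp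
  then obtain r :: "nat \<Rightarrow> nat" where r: "strict_mono r" "\<And>i. \<exists>l. (\<lambda>n. (x (r n) i, w (r n) i)) \<longlonglongrightarrow> l"
    using function_convergent_subsequence[of UNIV "\<lambda>n i. (x n i, w n i)" "sqrt C + 1"]
    by (metis countableI_type UNIV_I)
  from r(2) obtain l where l: "\<And>i. (\<lambda>n. (x (r n) i, w (r n) i)) \<longlonglongrightarrow> l i" by metis
  define X where "X i = fst (l i)" for i
  define W where "W i = snd (l i)" for i
  have X: "(\<lambda>n. x (r n) i) \<longlonglongrightarrow> X i" and W: "(\<lambda>n. w (r n) i) \<longlonglongrightarrow> W i" for i
    using tendsto_fst[OF l[of i]] tendsto_snd[OF l[of i]] by (simp_all add: X_def W_def)
  have X_le: "\<bar>X i\<bar> \<le> sqrt C" for i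
    by (rule LIMSEQ_le_const2[OF tendsto_rabs[OF X]]) (use x_le' in auto)
  have W_nonneg: "W i \<ge> 0" for i
    by (rule LIMSEQ_le_const[OF W]) (use w_nonneg in auto)
  have W_partial: "(\<Sum>i<m. W i) \<le> 1" for m
    by (rule LIMSEQ_le_const2[OF tendsto_sum[OF W]]) (use w_partial in auto)
  have W_sum: "summable W"
    using W_nonneg W_partial by (intro summableI_nonneg_bounded) auto
  have W_le: "suminf W \<le> 1"
    using W_partial by (intro suminf_le_const W_sum)
  \<comment> \<open>The atom of index \<open>0\<close> sits at \<open>0\<close> and receives the mass lost in the limit.\<close>
  define V where "V = case_nat (1 - suminf W) W"
  define Y where "Y = case_nat 0 X"
  have V_sum: "summable V"
    using W_sum unfolding V_def by (subst summable_Suc_iff[symmetric]) simp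
  have lim: "(\<lambda>n. \<Sum>i<r n. w (r n) i * f (x (r n) i)) \<longlonglongrightarrow> (\<Sum>i. V i * f (Y i))"
    if f: "continuous_on UNIV f" for f :: "real \<Rightarrow> real"
  proof -
    define g where "g y = f y - f 0" for y
    have g: "isCont g y" for y
      using f unfolding g_def continuous_on_eq_continuous_at[OF open_UNIV] by (intro continuous_intros) auto
    \<comment> \<open>The contribution of the first \<open>m\<close> atoms, and the whole integral.\<close>
    define F where "F m n = (\<Sum>i<m. w (r n) i * g (x (r n) i))" for m n
    define H where "H n = (\<Sum>i<r n. w (r n) i * g (x (r n) i))" for n
    have "compact (g ` {- sqrt C..sqrt C})"
      using g by (intro compact_continuous_image continuous_at_imp_continuous_on) auto
    then obtain B where B: "\<And>y. \<bar>y\<bar> \<le> sqrt C \<Longrightarrow> \<bar>g y\<bar> \<le> B"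
      by (metis (no_types, lifting) abs_le_iff atLeastAtMost_iff bounded_iff compact_imp_bounded imageI minus_le_iff real_norm_def)
    have unif: "uniform_limit UNIV F H sequentially"
    proof (rule uniform_limitI)
      fix e :: real assume e: "e > 0"
      obtain d where d: "d > 0" "\<And>y. \<bar>y\<bar> < d \<Longrightarrow> \<bar>g y\<bar> < e / 2"
        using g[of 0, unfolded continuous_at_eps_delta, rule_format, of "e / 2"] e
        by (auto simp: g_def dist_real_def)
      have "(\<lambda>i. sqrt (C / real (Suc i))) \<longlonglongrightarrow> sqrt 0"
        by (intro tendsto_real_sqrt LIMSEQ_Suc lim_const_over_n)
      then have "eventually (\<lambda>i. sqrt (C / real (Suc i)) < d) sequentially"
        using d(1) by (auto elim: order_tendstoD)
      then obtain M where M: "\<And>i. i \<ge> M \<Longrightarrow> sqrt (C / real (Suc i)) < d"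
        unfolding eventually_sequentially by auto
      have "dist (F m n) (H n) < e" if m: "m \<ge> M" for m n
      proof (cases "m \<le> r n")
        case True
        have "{..<r n} = {..<m} \<union> {m..<r n}" using True by auto
        then have "H n - F m n = (\<Sum>i\<in>{m..<r n}. w (r n) i * g (x (r n) i))"
          unfolding H_def F_def by (subst sum.union_disjoint[symmetric] | simp add: sum.union_disjoint ivl_disj_int)+
        also have "\<bar>\<dots>\<bar> \<le> (\<Sum>i\<in>{m..<r n}. w (r n) i * (e / 2))"
        proof (rule order_trans[OF sum_abs sum_mono])
          fix i assume "i \<in> {m..<r n}"
          then have "\<bar>x (r n) i\<bar> < d" using M[of i] x_le[of "r n" i] m by simp
          then have "\<bar>g (x (r n) i)\<bar> \<le> e / 2" using d(2) less_imp_le by blast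
          then show "\<bar>w (r n) i * g (x (r n) i)\<bar> \<le> w (r n) i * (e / 2)"
            using mult_left_mono[OF _ w_nonneg[of "r n" i]] w_nonneg[of "r n" i] by (simp only: abs_mult abs_of_nonneg)
        qed
        also have "\<dots> \<le> 1 * (e / 2)"
          unfolding sum_distrib_right[symmetric] using w_partial e by (intro mult_right_mono) auto
        finally show ?thesis using e by (simp add: dist_real_def abs_minus_commute)
      next
        case False
        then have "F m n = H n"
          unfolding F_def H_def by (intro sum.mono_neutral_right) (auto simp: w_0)
        then show ?thesis using e by simp
      qed
      then show "\<forall>\<^sub>F m in sequentially. \<forall>n\<in>UNIV. dist (F m n) (H n) < e"
        unfolding eventually_sequentially by blast
    qed
    have F_lim: "F m \<longlonglongrightarrow> (\<Sum>i<m. W i * g (X i))" for m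
      unfolding F_def by (intro tendsto_sum tendsto_mult W isCont_tendsto_compose[OF g X])
    have sW: "summable (\<lambda>i. W i * g (X i))"
      by (rule summable_comparison_test'[OF summable_mult2[OF W_sum, of B], of 0])
         (use B X_le W_nonneg in \<open>auto simp: abs_mult intro!: mult_left_mono\<close>)
    have "H \<longlonglongrightarrow> (\<Sum>i. W i * g (X i))"
      by (rule swap_uniform_limit'[OF always_eventually summable_LIMSEQ[OF sW] unif])
        (simp_all add: F_lim)
    then have "(\<lambda>n. f 0 + H n) \<longlonglongrightarrow> f 0 + (\<Sum>i. W i * g (X i))"
      by (intro tendsto_intros)
    moreover have "\<forall>\<^sub>F n in sequentially. f 0 + H n = (\<Sum>i<r n. w (r n) i * f (x (r n) i))"
    proof (rule eventually_mono[OF eventually_gt_at_top[of 0]])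
      fix n :: nat assume "n > 0"
      then have "r n > 0" using seq_suble[OF r(1), of n] by simp
      then show "f 0 + H n = (\<Sum>i<r n. w (r n) i * f (x (r n) i))"
        unfolding H_def g_def right_diff_distrib sum_subtractf sum_distrib_right[symmetric]
        using w_sum by simp
    qed
    ultimately have "(\<lambda>n. \<Sum>i<r n. w (r n) i * f (x (r n) i)) \<longlonglongrightarrow> f 0 + (\<Sum>i. W i * g (X i))"
      by (rule Lim_transform_eventually)
    moreover have "(\<Sum>i. V i * f (Y i)) = f 0 + (\<Sum>i. W i * g (X i))"
    proof -
      have eq: "W i * f (X i) = W i * g (X i) + f 0 * W i" for i by (simp add: g_def algebra_simps)
      have s: "summable (\<lambda>i. W i * f (X i))"
        unfolding eq by (intro summable_add sW summable_mult W_sum)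
      then have "summable (\<lambda>i. V i * f (Y i))"
        by (subst summable_Suc_iff[symmetric]) (simp add: V_def Y_def)
      then have "(\<Sum>i. V i * f (Y i)) = (\<Sum>i. W i * f (X i)) + (1 - suminf W) * f 0"
        using suminf_split_head[of "\<lambda>i. V i * f (Y i)"] by (simp add: V_def Y_def)
      also have "(\<Sum>i. W i * f (X i)) = (\<Sum>i. W i * g (X i)) + f 0 * suminf W"
        unfolding eq using sW W_sum by (simp add: suminf_add[symmetric] suminf_mult summable_mult)
      finally show ?thesis by (simp add: algebra_simps)
    qed
    ultimately show ?thesis by simp
  qed
  have "V i \<ge> 0" "\<bar>Y i\<bar> \<le> sqrt C" for i
    using W_nonneg W_le X_le C by (auto simp: V_def Y_def split: nat.split)
  with lim r(1) V_sum show ?thesis by (intro that[of r V Y])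
qed

text \<open>
  The measure is the image under \<open>Y\<close> of the measure on the natural numbers with masses \<open>V\<close>; so
  atoms with equal positions cause no difficulty.
\<close>
lemma purely_discrete_measure_exists:
  fixes V Y :: "nat \<Rightarrow> real"
  assumes V: "\<And>i. V i \<ge> 0" "summable V" and Y: "\<And>i. \<bar>Y i\<bar> \<le> B"
  obtains M where "purely_discrete M"
    "\<And>f :: real \<Rightarrow> real. continuous_on UNIV f \<Longrightarrow> integrable M f \<and> (\<integral>y. f y \<partial>M) = (\<Sum>i. V i * f (Y i))"
proof
  let ?D = "density (count_space UNIV) (\<lambda>i. ennreal (V i))"
  let ?M = "distr ?D borel Y"
  have Ym: "Y \<in> measurable ?D borel" by simp
  have "range Y \<in> sets borel" by (rule sets.countable) auto
  then have "UNIV - range Y \<in> sets borel" using sets.compl_sets[of "range Y" borel] by simp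
  then have "emeasure ?M (UNIV - range Y) = 0"
    by (subst emeasure_distr[OF Ym]) (auto simp: vimage_def)
  then show "purely_discrete ?M"
    unfolding purely_discrete_def by (intro conjI exI[of _ "range Y"]) auto
  fix f :: "real \<Rightarrow> real" assume f: "continuous_on UNIV f"
  have fm: "f \<in> borel_measurable borel" by (rule borel_measurable_continuous_onI[OF f])
  have "compact (f ` {- B..B})"
    using f by (intro compact_continuous_image continuous_on_subset[OF f]) auto
  then obtain K where K: "\<And>y. \<bar>y\<bar> \<le> B \<Longrightarrow> \<bar>f y\<bar> \<le> K"
    by (metis (no_types, lifting) abs_le_iff atLeastAtMost_iff bounded_iff compact_imp_bounded imageI minus_le_iff real_norm_def)
  have "summable (\<lambda>i. norm (V i * f (Y i)))"
    by (rule summable_comparison_test'[OF summable_mult2[OF V(2), of K], of 0])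
       (use K Y V(1) in \<open>auto simp: abs_mult intro!: mult_left_mono\<close>)
  then have i: "integrable (count_space UNIV) (\<lambda>i. V i * f (Y i))"
    by (simp add: integrable_count_space_nat_iff)
  show "integrable ?M f \<and> (\<integral>y. f y \<partial>?M) = (\<Sum>i. V i * f (Y i))"
    using i V(1) by (simp add: integrable_distr_eq[OF Ym fm] integral_distr[OF Ym fm]
       integrable_real_density integral_real_density integral_count_space_nat)
qed

section \<open>Orthogonality with respect to a discrete measure\<close>

text \<open>
  Favard's theorem for a Hilbert-Schmidt Jacobi matrix, which is what the two summability
  conditions express.  The measure is the limit of a subsequence of the quadrature rules; each
  integral of a product of two of the polynomials is already exact for all rules of high order.
\<close>
theorem discrete_favard:
  fixes b c :: "nat \<Rightarrow> real"
  assumes c: "\<And>n. c n > 0" and sum_b: "summable (\<lambda>n. (b n)\<^sup>2)" and sum_c: "summable c"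
  shows "\<exists>M :: real measure. purely_discrete M \<and>
    (\<forall>m n. integrable M (\<lambda>x. poly (jacobi_poly b c n) x * poly (jacobi_poly b c m) x) \<and>
       (\<integral>x. poly (jacobi_poly b c n) x * poly (jacobi_poly b c m) x \<partial>M) =
         (if m = n then \<Prod>i<n. c i else 0))"
proof -
  let ?p = "jacobi_poly b c :: nat \<Rightarrow> real poly"
  define C where "C = (\<Sum>n. (b n)\<^sup>2) + 2 * (\<Sum>n. c n)"
  have C: "C \<ge> 0"
    unfolding C_def using suminf_nonneg[OF sum_b] suminf_nonneg[OF sum_c less_imp_le[OF c]] by simp
  \<comment> \<open>A rule with \<open>N\<close> nodes, padded with weightless nodes at \<open>0\<close>, whose nodes obey the uniform bound.\<close>
  define quad where "quad N x w \<longleftrightarrow> (\<forall>i. w i \<ge> 0) \<and> (\<forall>i\<ge>N. w i = 0) \<and> (\<forall>i. real (Suc i) * (x i)\<^sup>2 \<le> C) \<and>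
      (\<forall>k<N. \<forall>l<N. (\<Sum>i<N. w i * (poly (?p k) (x i) * poly (?p l) (x i))) = (if k = l then \<Prod>i<k. c i else 0))"
    for N and x w :: "nat \<Rightarrow> real"
  have "\<exists>x w. quad N x w" for N
  proof (rule gauss_quadrature_jacobi_poly[where b = b and c = c and N = N, OF c])
    fix x w assume root: "\<And>i. i < N \<Longrightarrow> poly (?p N) (x i) = 0"
      and desc: "\<And>i j. i \<le> j \<Longrightarrow> j < N \<Longrightarrow> \<bar>x j\<bar> \<le> \<bar>x i\<bar>" and w_pos: "\<And>i. w i > 0"
      and w: "\<And>i. i < N \<Longrightarrow> w i * (\<Sum>k<N. (poly (?p k) (x i))\<^sup>2 / (\<Prod>i<k. c i)) = 1"
      and orth: "\<And>k l. k < N \<Longrightarrow> l < N \<Longrightarrow>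
       (\<Sum>i<N. w i * (poly (?p k) (x i) * poly (?p l) (x i))) = (if k = l then \<Prod>i<k. c i else 0)"
    have sq: "(\<Sum>i<N. (x i)\<^sup>2) \<le> C"
      unfolding C_def by (rule jacobi_quadrature_square_nodes[OF c sum_b sum_c root w orth])
    \<comment> \<open>The first \<open>i + 1\<close> nodes are at least as large in absolute value as the \<open>i\<close>-th one.\<close>
    have dec: "real (Suc i) * (x i)\<^sup>2 \<le> C" if "i < N" for i
    proof -
      have "real (Suc i) * (x i)\<^sup>2 = (\<Sum>j\<le>i. (x i)\<^sup>2)" by simp
      also have "\<dots> \<le> (\<Sum>j\<le>i. (x j)\<^sup>2)"
        using desc that by (intro sum_mono) (simp add: abs_le_square_iff)
      also have "\<dots> \<le> (\<Sum>i<N. (x i)\<^sup>2)"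
        using that by (intro sum_mono2) auto
      finally show ?thesis using sq by simp
    qed
    have "quad N (\<lambda>i. if i < N then x i else 0) (\<lambda>i. if i < N then w i else 0)"
      unfolding quad_def using dec w_pos C orth by (auto intro: less_imp_le)
    then show "\<exists>x w. quad N x w" by blast
  qed
  then obtain x w where "\<And>N. quad N (x N) (w N)" by metis
  then have w_nonneg: "w N i \<ge> 0" and w_0: "i \<ge> N \<Longrightarrow> w N i = 0" and x: "real (Suc i) * (x N i)\<^sup>2 \<le> C"
    and orth: "k < N \<Longrightarrow> l < N \<Longrightarrow>
       (\<Sum>i<N. w N i * (poly (?p k) (x N i) * poly (?p l) (x N i))) = (if k = l then \<Prod>i<k. c i else 0)"
    for N i k l unfolding quad_def by blast+
  have w_sum: "(\<Sum>i<N. w N i) = 1" if "N > 0" for N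
    using orth[of 0 N 0] that by simp
  obtain r :: "nat \<Rightarrow> nat" and V Y :: "nat \<Rightarrow> real" where r: "strict_mono r"
    and V: "\<And>i. V i \<ge> 0" "summable V" and Y: "\<And>i. \<bar>Y i\<bar> \<le> sqrt C"
    and lim: "\<And>f :: real \<Rightarrow> real. continuous_on UNIV f \<Longrightarrow>
       (\<lambda>n. \<Sum>i<r n. w (r n) i * f (x (r n) i)) \<longlonglongrightarrow> (\<Sum>i. V i * f (Y i))"
    by (rule discrete_helly_selection[of w x C, OF w_nonneg w_0 w_sum x]) blast+
  obtain M where M: "purely_discrete M"
    "\<And>f :: real \<Rightarrow> real. continuous_on UNIV f \<Longrightarrow> integrable M f \<and> (\<integral>y. f y \<partial>M) = (\<Sum>i. V i * f (Y i))"
    by (rule purely_discrete_measure_exists[of V Y "sqrt C", OF V Y]) blast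
  have "integrable M (\<lambda>x. poly (?p n) x * poly (?p m) x) \<and>
       (\<integral>x. poly (?p n) x * poly (?p m) x \<partial>M) = (if m = n then \<Prod>i<n. c i else 0)" for m n
  proof -
    let ?f = "\<lambda>x. poly (?p n) x * poly (?p m) x"
    have f: "continuous_on UNIV ?f" by (intro continuous_intros)
    have "\<forall>\<^sub>F N in sequentially. (\<Sum>i<r N. w (r N) i * ?f (x (r N) i)) = (if m = n then \<Prod>i<n. c i else 0)"
    proof (rule eventually_mono[OF eventually_gt_at_top[of "max m n"]])
      fix N assume "max m n < N"
      then have "n < r N" "m < r N" using seq_suble[OF r, of N] by auto
      then show "(\<Sum>i<r N. w (r N) i * ?f (x (r N) i)) = (if m = n then \<Prod>i<n. c i else 0)"
        using orth[of n "r N" m] by auto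
    qed
    then have "(\<lambda>N. \<Sum>i<r N. w (r N) i * ?f (x (r N) i)) \<longlonglongrightarrow> (if m = n then \<Prod>i<n. c i else 0)"
      by (rule tendsto_eventually)
    from LIMSEQ_unique[OF lim[OF f] this] M(2)[OF f] show ?thesis by simp
  qed
  with M(1) show ?thesis by blast
qed

lemma Q_eq_jacobi_poly:
  assumes q: "0 < q" "q < 1"
  shows "Q q a lam n x = poly (jacobi_poly (\<lambda>k. - a * q ^ k) (\<lambda>k. - lam * q ^ Suc k) n) x"
  (is "_ = poly (jacobi_poly ?b ?c n) x")
proof (induction ?b ?c n rule: jacobi_poly.induct)
  case (3 n)
  then show ?case
    unfolding Q_recurrence[OF q] poly_jacobi_poly_Suc_Suc by simp
qed (simp_all add: Q_0[OF q] Q_Suc_0[OF q])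

theorem theorem6p1:
  fixes q a lam :: real
  assumes "0 < q" and "q < 1" and "lam < 0"
  shows "\<exists>M :: real measure. purely_discrete M \<and>
    (\<forall>m n. integrable M (\<lambda>x. Q q a lam n x * Q q a lam m x) \<and>
       (\<integral>x. Q q a lam n x * Q q a lam m x \<partial>M) =
         (if m = n then (- lam) ^ n * q ^ ((n + 1) choose 2) else 0))"
proof -
  let ?b = "\<lambda>k. - a * q ^ k" and ?c = "\<lambda>k. - lam * q ^ Suc k"
  have c: "?c n > 0" for n using assms by (simp add: mult_neg_pos)
  have "(?b n)\<^sup>2 = a\<^sup>2 * (q\<^sup>2) ^ n" for n
    by (simp add: power_mult_distrib power_mult[symmetric] mult.commute)
  moreover have "q\<^sup>2 < 1" using assms by (simp add: power_less_one_iff)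
  ultimately have b: "summable (\<lambda>n. (?b n)\<^sup>2)"
    by (simp add: summable_mult summable_geometric)
  have "summable ?c"
    using assms by (intro summable_mult) (simp add: summable_mult summable_geometric)
  moreover have "(\<Prod>i<n. ?c i) = (- lam) ^ n * q ^ ((n + 1) choose 2)" for n
    by (induction n) (simp_all add: numeral_2_eq_2 power_add)
  ultimately show ?thesis
    using discrete_favard[of ?c ?b, OF c b] unfolding Q_eq_jacobi_poly[OF assms(1,2)] by (simp only:)
qed

end
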